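(* Let $g$ be the odd analytic solution of $$(g g')''=\tfrac13\, z\, g' \ \text{ in } \mathbb{R},\qquad g(-\infty)=1,\quad g(+\infty)=-1,\qquad g(0)=g''(0)=0,$$ with $g(z)>0$ for $z<0$. Then the function $G(z)=g(-z)$ satisfies $$(G G')''=-\tfrac13\, z\, G'\ \text{ in }\mathbb{R},\qquad G(-\infty)=-1,\quad G(+\infty)=1,$$ the function $u_+(x,t)=G\big(x/t^{1/3}\big)$ is a solution of $u_t=(uu_x)_{xx}$ in $\mathbb{R}\times(0,\infty)$, and $$u_+(\cdot,t)\to S_+\quad\text{in } L^1_{\rm loc}(\mathbb{R})\ \text{ as } t\to0^+,\qquad\text{where } S_+(x)=\operatorname{sign}x .$$
   Context: Here $'=d/dz$, $g(\pm\infty)=\lim_{z\to\pm\infty}g(z)$, and $\operatorname{sign}0=0$. Existence and uniqueness of $g$ with the listed properties may be taken as given. Convergence in $L^1_{\rm loc}(\mathbb{R})$ means convergence in $L^1(-l,l)$ for every finite $l>0$. The function $u_+$ is called the rarefaction similarity solution of the Riemann problem with initial data $S_+$. *)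

theory Defs
  imports "HOL-Analysis.Analysis"
begin

definition real_analytic :: "(real \<Rightarrow> real) \<Rightarrow> bool" where
  "real_analytic f \<longleftrightarrow>
     (\<forall>z0. \<exists>r>0. \<exists>a :: nat \<Rightarrow> real. \<forall>z. \<bar>z - z0\<bar> < r \<longrightarrow> (\<lambda>n. a n * (z - z0) ^ n) sums f z)"

text \<open>
  Since \<^const>\<open>deriv\<close> is a total operator, the existence of the derivatives that enter an
  equation is part of the notion of solution. The two predicates below describe classical
  solutions, that is, of class \<open>C\<^sup>3\<close> in the space variable (and \<open>C\<^sup>1\<close> in time).
\<close>

definition similarity_ode_solution :: "real \<Rightarrow> (real \<Rightarrow> real) \<Rightarrow> bool" where
  "similarity_ode_solution c f \<longleftrightarrow>
     (\<forall>k<3. \<forall>z. (deriv ^^ k) f differentiable (at z)) \<and>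
     continuous_on UNIV ((deriv ^^ 3) f) \<and>
     (\<forall>z. (deriv ^^ 2) (\<lambda>y. f y * deriv f y) z = c * z * deriv f z)"

definition nde_solution :: "(real \<Rightarrow> real \<Rightarrow> real) \<Rightarrow> bool" where
  "nde_solution u \<longleftrightarrow>
     (\<forall>k<3. \<forall>x. \<forall>t>0. (deriv ^^ k) (\<lambda>y. u y t) differentiable (at x)) \<and>
     (\<forall>k\<le>3. continuous_on (UNIV \<times> {0<..}) (\<lambda>(x, t). (deriv ^^ k) (\<lambda>y. u y t) x)) \<and>
     (\<forall>x. \<forall>t>0. (\<lambda>s. u x s) differentiable (at t)) \<and>
     continuous_on (UNIV \<times> {0<..}) (\<lambda>(x, t). deriv (\<lambda>s. u x s) t) \<and>
     (\<forall>x. \<forall>t>0. deriv (\<lambda>s. u x s) t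
        = (deriv ^^ 2) (\<lambda>y. u y t * deriv (\<lambda>\<xi>. u \<xi> t) y) x)"

text \<open>
  The Bochner integral of a non-integrable function is 0, so membership in \<open>L\<^sup>1(-l, l)\<close> is
  required explicitly.
\<close>

definition tendsto_L1_loc :: "('a \<Rightarrow> real \<Rightarrow> real) \<Rightarrow> (real \<Rightarrow> real) \<Rightarrow> 'a filter \<Rightarrow> bool" where
  "tendsto_L1_loc v w F \<longleftrightarrow>
     (\<forall>l>0. set_integrable lborel {-l<..<l} w \<and>
        (\<forall>\<^sub>F t in F. set_integrable lborel {-l<..<l} (v t)) \<and>
        ((\<lambda>t. set_lebesgue_integral lborel {-l<..<l} (\<lambda>x. \<bar>v t x - w x\<bar>)) \<longlongrightarrow> 0) F)"

text \<open>The cube root of a positive \<open>t\<close> is \<open>t powr (1 / 3)\<close>; only \<open>t > 0\<close> is relevant.\<close>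

definition similarity_solution :: "(real \<Rightarrow> real) \<Rightarrow> real \<Rightarrow> real \<Rightarrow> real" where
  "similarity_solution G x t = G (x / t powr (1 / 3))"

end

theory Submission
  imports Defs
begin

text \<open>
  By the product rule \<open>(f f')'' = 3 f' f'' + f f'''\<close> (\<open>deriv2_mult_deriv\<close>), so both equations
  are algebraic identities between the derivatives of the profile. Under the substitution
  \<open>z \<mapsto> a z\<close> the \<open>k\<close>-th derivative picks up the factor \<open>a\<^sup>k\<close> (\<open>deriv_funpow_scale\<close>), and so each
  term of the diffusion picks up \<open>a\<^sup>3\<close> (\<open>deriv2_mult_deriv_scale\<close>). This is used twice:

  \<^item> \<open>a = - 1\<close>: the reflection \<open>G\<close> of \<open>g\<close> solves the equation with the opposite constant, because
    \<open>a\<^sup>3 = - 1\<close>, while \<open>z f'(z)\<close> becomes the corresponding term for the reflected function.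

  \<^item> \<open>a = t powr (- 1 / 3)\<close>: the diffusion term of \<open>u(x, t) = G(x / t powr (1 / 3))\<close> is \<open>1 / t\<close> times
    that of \<open>G\<close> at \<open>z = a x\<close>, and \<open>\<partial>z / \<partial>t = - z / (3 t)\<close> gives \<open>u\<^sub>t = - z G'(z) / (3 t)\<close>. Hence the
    partial differential equation for \<open>u\<close> is the ordinary one for \<open>G\<close>, divided by \<open>t\<close>.

  For the initial data, \<open>x / t powr (1 / 3)\<close> tends to \<open>\<plusminus>\<infinity>\<close> as \<open>t\<close> decreases to 0, according to the
  sign of \<open>x\<close>, so \<open>u(x, t)\<close> tends to \<open>sgn x\<close> for every \<open>x \<noteq> 0\<close>. Being continuous with finite limits
  at both ends, \<open>G\<close> is bounded, and dominated convergence on \<open>(-l, l)\<close> turns the pointwise limit into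
  an \<open>L\<^sup>1\<close> limit.
\<close>

section \<open>Derivatives of scaled functions\<close>

lemma deriv_funpow_has_real_derivative:
  fixes f :: "real \<Rightarrow> real"
  assumes "\<forall>k<n. \<forall>z. (deriv ^^ k) f differentiable (at z)" and "k < n"
  shows "((deriv ^^ k) f has_real_derivative (deriv ^^ Suc k) f z) (at z)"
  using assms by (simp add: DERIV_deriv_iff_real_differentiable)

lemma deriv_funpow_scale:
  fixes f :: "real \<Rightarrow> real"
  assumes diff: "\<forall>k<n. \<forall>z. (deriv ^^ k) f differentiable (at z)" and "k \<le> n"
  shows "(deriv ^^ k) (\<lambda>y. f (a * y)) = (\<lambda>x. a ^ k * (deriv ^^ k) f (a * x))"
  using \<open>k \<le> n\<close>
proof (induction k)
  case 0
  then show ?case by simp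
next
  case (Suc k)
  have "((\<lambda>x. a ^ k * (deriv ^^ k) f (a * x)) has_real_derivative
      a ^ Suc k * (deriv ^^ Suc k) f (a * x)) (at x)" for x
  proof -
    have "((deriv ^^ k) f has_real_derivative (deriv ^^ Suc k) f (a * x)) (at (a * x))"
      using deriv_funpow_has_real_derivative[OF diff] Suc.prems by simp
    from DERIV_chain2[where g = "\<lambda>x. a * x" and Db = a, OF this]
    have "((\<lambda>x. (deriv ^^ k) f (a * x)) has_real_derivative
        (deriv ^^ Suc k) f (a * x) * a) (at x)"
      by (auto intro!: derivative_eq_intros)
    from DERIV_cmult[OF this, of "a ^ k"] show ?thesis
      by (simp add: mult_ac)
  qed
  then have "deriv (\<lambda>x. a ^ k * (deriv ^^ k) f (a * x))
      = (\<lambda>x. a ^ Suc k * (deriv ^^ Suc k) f (a * x))"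
    by (intro ext DERIV_imp_deriv)
  then show ?case
    using Suc by simp
qed

lemma deriv_funpow_scale_differentiable:
  fixes f :: "real \<Rightarrow> real"
  assumes diff: "\<forall>k<n. \<forall>z. (deriv ^^ k) f differentiable (at z)" and "k < n"
  shows "(deriv ^^ k) (\<lambda>y. f (a * y)) differentiable (at x)"
proof -
  have "(\<lambda>x. (deriv ^^ k) f (a * x)) differentiable (at x)"
    using differentiable_compose[of "(deriv ^^ k) f" "\<lambda>x. a * x" x UNIV] diff \<open>k < n\<close> by simp
  then show ?thesis
    using \<open>k < n\<close> by (simp add: deriv_funpow_scale[OF diff])
qed

text \<open>
  Expanding the diffusion term removes the only derivatives in either equation that are not
  derivatives of the profile itself.
\<close>

lemma deriv2_mult_deriv:
  fixes f :: "real \<Rightarrow> real"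
  assumes diff: "\<forall>k<3. \<forall>z. (deriv ^^ k) f differentiable (at z)"
  shows "(deriv ^^ 2) (\<lambda>y. f y * deriv f y) z
    = 3 * deriv f z * (deriv ^^ 2) f z + f z * (deriv ^^ 3) f z"
proof -
  note D = deriv_funpow_has_real_derivative[OF diff]
  have D0: "(f has_real_derivative deriv f z) (at z)" for z
    using D[of 0] by simp
  have D1: "(deriv f has_real_derivative (deriv ^^ 2) f z) (at z)" for z
    using D[of 1] by (simp add: numeral_2_eq_2)
  have D2: "((deriv ^^ 2) f has_real_derivative (deriv ^^ 3) f z) (at z)" for z
    using D[of 2] by (simp add: numeral_3_eq_3 numeral_2_eq_2)
  have "((\<lambda>y. f y * deriv f y) has_real_derivative
      deriv f z * deriv f z + f z * (deriv ^^ 2) f z) (at z)" for z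
    by (rule derivative_eq_intros D0 D1 refl)+ (simp add: algebra_simps)
  then have 1: "deriv (\<lambda>y. f y * deriv f y)
      = (\<lambda>z. deriv f z * deriv f z + f z * (deriv ^^ 2) f z)"
    by (simp add: fun_eq_iff DERIV_imp_deriv)
  have "((\<lambda>z. deriv f z * deriv f z + f z * (deriv ^^ 2) f z) has_real_derivative
      3 * deriv f z * (deriv ^^ 2) f z + f z * (deriv ^^ 3) f z) (at z)"
    by (rule derivative_eq_intros D0 D1 D2 refl)+ (simp add: algebra_simps)
  then have "deriv (deriv (\<lambda>y. f y * deriv f y)) z
      = 3 * deriv f z * (deriv ^^ 2) f z + f z * (deriv ^^ 3) f z"
    unfolding 1 by (rule DERIV_imp_deriv)
  then show ?thesis
    by (simp add: numeral_2_eq_2)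
qed

text \<open>
  One factor \<open>a\<close> comes from each of the three differentiations in \<open>(f f')''\<close>.
\<close>

lemma deriv2_mult_deriv_scale:
  fixes f :: "real \<Rightarrow> real"
  assumes diff: "\<forall>k<3. \<forall>z. (deriv ^^ k) f differentiable (at z)"
  shows "(deriv ^^ 2) (\<lambda>y. f (a * y) * deriv (\<lambda>\<xi>. f (a * \<xi>)) y) x
    = a ^ 3 * (deriv ^^ 2) (\<lambda>y. f y * deriv f y) (a * x)"
proof -
  have diff': "\<forall>k<3. \<forall>z. (deriv ^^ k) (\<lambda>y. f (a * y)) differentiable (at z)"
    using deriv_funpow_scale_differentiable[OF diff] by blast
  have scale: "(deriv ^^ k) (\<lambda>y. f (a * y)) x = a ^ k * (deriv ^^ k) f (a * x)" if "k \<le> 3" for k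
    using deriv_funpow_scale[OF diff that] by simp
  have scale1: "deriv (\<lambda>y. f (a * y)) x = a * deriv f (a * x)"
    using scale[of 1] by simp
  show ?thesis
    unfolding deriv2_mult_deriv[OF diff] deriv2_mult_deriv[OF diff'] scale1
      scale[of 2, simplified] scale[of 3, simplified]
    by (simp add: algebra_simps power2_eq_square power3_eq_cube)
qed

section \<open>The two equations\<close>

lemma similarity_ode_solution_reflect:
  assumes "similarity_ode_solution c f"
  shows "similarity_ode_solution (- c) (\<lambda>z. f (- z))"
proof -
  have diff: "\<forall>k<3. \<forall>z. (deriv ^^ k) f differentiable (at z)"
    and cont: "continuous_on UNIV ((deriv ^^ 3) f)"
    and ode: "\<And>z. (deriv ^^ 2) (\<lambda>y. f y * deriv f y) z = c * z * deriv f z"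
    using assms by (auto simp: similarity_ode_solution_def)
  have scale: "(deriv ^^ k) (\<lambda>y. f (- y)) = (\<lambda>x. (- 1) ^ k * (deriv ^^ k) f (- x))"
    if "k \<le> 3" for k
    using deriv_funpow_scale[OF diff that, of "- 1"] by simp
  have "(deriv ^^ k) (\<lambda>y. f (- y)) differentiable (at z)" if "k < 3" for k z
    using deriv_funpow_scale_differentiable[OF diff that, of "- 1"] by simp
  moreover have "continuous_on UNIV ((deriv ^^ 3) (\<lambda>y. f (- y)))"
    unfolding scale[OF order_refl]
    by (intro continuous_on_compose2[OF cont] continuous_intros) auto
  moreover have "(deriv ^^ 2) (\<lambda>y. f (- y) * deriv (\<lambda>\<xi>. f (- \<xi>)) y) z
      = - c * z * deriv (\<lambda>y. f (- y)) z" for z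
    using deriv2_mult_deriv_scale[OF diff, of "- 1" z] scale[of 1] by (simp add: ode)
  ultimately show ?thesis
    unfolding similarity_ode_solution_def by blast
qed

lemma nde_solution_similarity_solution:
  assumes "similarity_ode_solution (- (1 / 3)) G"
  shows "nde_solution (similarity_solution G)"
proof -
  have diff: "\<forall>k<3. \<forall>z. (deriv ^^ k) G differentiable (at z)"
    and cont3: "continuous_on UNIV ((deriv ^^ 3) G)"
    and ode: "\<And>z. (deriv ^^ 2) (\<lambda>y. G y * deriv G y) z = - (1 / 3) * z * deriv G z"
    using assms by (auto simp: similarity_ode_solution_def)
  define a where "a t = t powr (- 1 / 3)" for t :: real
  have u: "similarity_solution G x t = G (a t * x)" for x t
    by (simp add: similarity_solution_def a_def powr_minus_divide)
  have a_cube: "a t ^ 3 = 1 / t" if "t > 0" for t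
  proof -
    have "a t ^ 3 = t powr (- 1 / 3 + - 1 / 3 + - 1 / 3)"
      unfolding a_def power3_eq_cube powr_add ..
    then show ?thesis
      using that by (simp add: powr_minus_divide)
  qed
  have a_deriv: "(a has_real_derivative - 1 / 3 * (a t / t)) (at t)" if "t > 0" for t
  proof -
    have eq: "t powr (- 1 / 3 - 1) = t powr (- 1 / 3) / t"
      using that by (simp only: powr_diff powr_one less_imp_le)
    show ?thesis
      unfolding a_def
      by (rule DERIV_cong[OF has_real_derivative_powr[OF that]]) (subst eq, rule refl)
  qed
  have cont_a: "continuous_on (UNIV \<times> {0<..}) (\<lambda>p :: real \<times> real. a (snd p))"
    unfolding a_def by (intro continuous_intros) auto
  have cont: "continuous_on UNIV ((deriv ^^ k) G)" if "k \<le> 3" for k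
  proof (cases "k = 3")
    case False
    then show ?thesis
      using diff that by (simp add: differentiable_imp_continuous_on differentiable_on_def)
  qed (use cont3 in simp)
  have cont_scaled: "continuous_on (UNIV \<times> {0<..})
      (\<lambda>p :: real \<times> real. (deriv ^^ k) G (a (snd p) * fst p))" if "k \<le> 3" for k
    using cont_a by (intro continuous_on_compose2[OF cont[OF that]] continuous_intros) auto
  have dt: "((\<lambda>s. G (a s * x)) has_real_derivative - (1 / 3) * (a t * x) * deriv G (a t * x) / t)
      (at t)" if "t > 0" for x t
  proof -
    have "(G has_real_derivative deriv G (a t * x)) (at (a t * x))"
      using deriv_funpow_has_real_derivative[OF diff, of 0] by simp
    from DERIV_chain2[where g = "\<lambda>s. a s * x",
        OF this DERIV_cmult_right[OF a_deriv[OF that]]]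
    show ?thesis
      by (simp add: mult_ac)
  qed
  have "continuous_on (UNIV \<times> {0<..}) (\<lambda>(x, t). (deriv ^^ k) (\<lambda>y. G (a t * y)) x)"
    if "k \<le> 3" for k
    using cont_scaled[OF that] cont_a that
    by (auto simp: deriv_funpow_scale[OF diff] case_prod_unfold intro!: continuous_intros)
  moreover have "continuous_on (UNIV \<times> {0<..}) (\<lambda>(x, t). deriv (\<lambda>s. G (a s * x)) t)"
  proof -
    have "continuous_on (UNIV \<times> {0<..}) (\<lambda>p :: real \<times> real.
        - (1 / 3) * (a (snd p) * fst p) * deriv G (a (snd p) * fst p) / snd p)"
      using cont_scaled[of 1] cont_a by (intro continuous_intros) auto
    then show ?thesis
      by (rule continuous_on_eq) (auto simp: DERIV_imp_deriv[OF dt])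
  qed
  moreover have "(deriv ^^ k) (\<lambda>y. G (a t * y)) differentiable (at x)" if "k < 3" for k t x
    using deriv_funpow_scale_differentiable[OF diff that] .
  moreover have "(\<lambda>s. G (a s * x)) differentiable (at t)" if "t > 0" for x t
    using dt[OF that] real_differentiable_def by blast
  moreover have "deriv (\<lambda>s. G (a s * x)) t
      = (deriv ^^ 2) (\<lambda>y. G (a t * y) * deriv (\<lambda>\<xi>. G (a t * \<xi>)) y) x" if "t > 0" for x t
    unfolding deriv2_mult_deriv_scale[OF diff] ode a_cube[OF that] DERIV_imp_deriv[OF dt[OF that]]
    by simp
  ultimately show ?thesis
    unfolding nde_solution_def u by blast
qed

section \<open>The initial data\<close>

lemma continuous_tendsto_imp_bounded:
  fixes f :: "real \<Rightarrow> real"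
  assumes cont: "continuous_on UNIV f"
    and bot: "(f \<longlongrightarrow> l) at_bot" and top: "(f \<longlongrightarrow> m) at_top"
  obtains B where "\<And>x. \<bar>f x\<bar> \<le> B"
proof -
  have "\<forall>\<^sub>F x in at_bot. \<bar>f x\<bar> < \<bar>l\<bar> + 1"
    by (rule order_tendstoD(2)[OF tendsto_rabs[OF bot]]) simp
  then obtain p where p: "\<And>x. x \<le> p \<Longrightarrow> \<bar>f x\<bar> < \<bar>l\<bar> + 1"
    by (auto simp: eventually_at_bot_linorder)
  have "\<forall>\<^sub>F x in at_top. \<bar>f x\<bar> < \<bar>m\<bar> + 1"
    by (rule order_tendstoD(2)[OF tendsto_rabs[OF top]]) simp
  then obtain q where q: "\<And>x. x \<ge> q \<Longrightarrow> \<bar>f x\<bar> < \<bar>m\<bar> + 1"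
    by (auto simp: eventually_at_top_linorder)
  have "bounded (f ` {p..q})"
    by (intro compact_imp_bounded compact_continuous_image continuous_on_subset[OF cont]) auto
  then obtain B where B: "\<And>x. x \<in> {p..q} \<Longrightarrow> \<bar>f x\<bar> \<le> B"
    unfolding bounded_iff real_norm_def by blast
  have "\<bar>f x\<bar> \<le> max B (max (\<bar>l\<bar> + 1) (\<bar>m\<bar> + 1))" for x
    using p[of x] q[of x] B[of x] by (cases "x \<le> p"; cases "x \<ge> q") (auto simp: le_max_iff_disj)
  then show thesis
    using that by blast
qed

text \<open>
  Only the behaviour of \<open>G\<close> at infinity matters, since for fixed \<open>x \<noteq> 0\<close> the similarity variable
  leaves every bounded set; the value at \<open>x = 0\<close> stays \<open>G 0\<close> for all \<open>t\<close>, but a single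
  point is null.
\<close>

lemma similarity_solution_tendsto_sgn:
  assumes bot: "(G \<longlongrightarrow> - 1) at_bot" and top: "(G \<longlongrightarrow> 1) at_top" and "x \<noteq> 0"
  shows "((\<lambda>t. similarity_solution G x t) \<longlongrightarrow> sgn x) (at_right 0)"
proof -
  have "((\<lambda>t :: real. t powr (1 / 3)) \<longlongrightarrow> 0) (at_right 0)"
    by (rule tendsto_eq_rhs[OF tendsto_powr']) (auto intro!: tendsto_intros simp: eventually_at_filter)
  then have s: "filterlim (\<lambda>t :: real. t powr (1 / 3)) (at_right 0) (at_right 0)"
    by (auto simp: filterlim_at eventually_at_filter)
  have inv: "filterlim (\<lambda>t :: real. inverse (t powr (1 / 3))) at_top (at_right 0)"
    by (rule filterlim_compose[OF filterlim_inverse_at_top_right s])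
  show ?thesis
  proof (cases "x > 0")
    case True
    have "filterlim (\<lambda>t. x / t powr (1 / 3)) at_top (at_right 0)"
      unfolding divide_inverse[of x]
      by (rule filterlim_tendsto_pos_mult_at_top[OF tendsto_const True inv])
    from filterlim_compose[OF top this] show ?thesis
      using True by (simp add: similarity_solution_def)
  next
    case False
    with \<open>x \<noteq> 0\<close> have "x < 0" by simp
    have "filterlim (\<lambda>t. x / t powr (1 / 3)) at_bot (at_right 0)"
      unfolding divide_inverse[of x]
      by (rule filterlim_tendsto_neg_mult_at_bot[OF tendsto_const \<open>x < 0\<close> inv])
    from filterlim_compose[OF bot this] show ?thesis
      using \<open>x < 0\<close> by (simp add: similarity_solution_def)
  qed
qed

lemma similarity_solution_tendsto_L1_loc:
  assumes cont: "continuous_on UNIV G"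
    and bot: "(G \<longlongrightarrow> - 1) at_bot" and top: "(G \<longlongrightarrow> 1) at_top"
  shows "tendsto_L1_loc (\<lambda>t x. similarity_solution G x t) sgn (at_right 0)"
proof -
  let ?u = "similarity_solution G"
  obtain B where B: "\<And>z. \<bar>G z\<bar> \<le> B"
    using continuous_tendsto_imp_bounded[OF cont bot top] by blast
  have [measurable]: "G \<in> borel_measurable borel"
    by (rule borel_measurable_continuous_onI[OF cont])
  have [measurable]: "(\<lambda>x. ?u x t) \<in> borel_measurable borel" for t
    unfolding similarity_solution_def by measurable
  have integrable: "set_integrable lborel {-l<..<l} f"
    if "f \<in> borel_measurable borel" "\<And>x. \<bar>f x\<bar> \<le> C" for f :: "real \<Rightarrow> real" and l C
    unfolding set_integrable_def
  proof (rule integrableI_bounded_set_indicator)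
    show "AE x in lborel. x \<in> {-l<..<l} \<longrightarrow> norm (f x) \<le> C"
      using that(2) by simp
  qed (use that(1) emeasure_bounded_finite[of "{-l<..<l}"] in auto)
  have sgn_le: "\<bar>sgn x :: real\<bar> \<le> 1" for x
    by (simp add: sgn_real_def)
  have "((\<lambda>t. LINT x:{-l<..<l}|lborel. \<bar>?u x t - sgn x\<bar>) \<longlongrightarrow> 0) (at_right 0)" for l
    unfolding tendsto_at_iff_sequentially
  proof (intro allI impI)
    fix T :: "nat \<Rightarrow> real"
    assume "\<forall>n. T n \<in> {0<..} - {0}" "T \<longlonglongrightarrow> 0"
    then have T: "filterlim T (at_right 0) sequentially"
      by (auto simp: filterlim_at intro!: always_eventually) (metis less_irrefl)
    have "(\<lambda>n. LINT x|lborel. indicator {-l<..<l} x *\<^sub>R \<bar>?u x (T n) - sgn x\<bar>)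
        \<longlonglongrightarrow> integral\<^sup>L lborel (\<lambda>_ :: real. 0 :: real)"
    proof (rule integral_dominated_convergence)
      show "integrable lborel (\<lambda>x. indicator {-l<..<l} x *\<^sub>R (B + 1))"
        using integrable[of "\<lambda>_. B + 1" "\<bar>B + 1\<bar>" l] by (simp add: set_integrable_def)
      show "AE x in lborel. (\<lambda>n. indicator {-l<..<l} x *\<^sub>R \<bar>?u x (T n) - sgn x\<bar>) \<longlonglongrightarrow> 0"
        using AE_lborel_singleton[of 0]
      proof eventually_elim
        case (elim x)
        from filterlim_compose[OF similarity_solution_tendsto_sgn[OF bot top elim] T]
        show ?case
          by (auto intro!: tendsto_eq_intros)
      qed
      show "AE x in lborel. norm (indicator {-l<..<l} x *\<^sub>R \<bar>?u x (T n) - sgn x\<bar>)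
          \<le> indicator {-l<..<l} x *\<^sub>R (B + 1)" for n
      proof (rule AE_I2)
        fix x
        have "\<bar>?u x (T n) - sgn x\<bar> \<le> B + 1"
          using B[of "x / T n powr (1 / 3)"] sgn_le[of x] unfolding similarity_solution_def
          by linarith
        then show "norm (indicator {-l<..<l} x *\<^sub>R \<bar>?u x (T n) - sgn x\<bar>)
          \<le> indicator {-l<..<l} x *\<^sub>R (B + 1)"
          by (simp add: indicator_def)
      qed
    qed measurable
    then show "((\<lambda>t. LINT x:{-l<..<l}|lborel. \<bar>?u x t - sgn x\<bar>) \<circ> T) \<longlonglongrightarrow> 0"
      by (simp add: set_lebesgue_integral_def comp_def)
  qed
  moreover have "set_integrable lborel {-l<..<l} (\<lambda>x. ?u x t)" for l t
    by (rule integrable[where C = B]) (auto simp: similarity_solution_def B)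
  moreover have "set_integrable lborel {-l<..<l} (sgn :: real \<Rightarrow> real)" for l
    by (rule integrable[OF _ sgn_le]) measurable
  ultimately show ?thesis
    by (simp add: tendsto_L1_loc_def)
qed

section \<open>The rarefaction similarity solution\<close>

theorem mainTheorem3:
  fixes g G :: "real \<Rightarrow> real" and u_plus :: "real \<Rightarrow> real \<Rightarrow> real"
  assumes g_analytic: "real_analytic g"
    and g_odd: "\<And>z. g (- z) = - g z"
    and g_ode: "similarity_ode_solution (1 / 3) g"
    and g_at_bot: "(g \<longlongrightarrow> 1) at_bot"
    and g_at_top: "(g \<longlongrightarrow> - 1) at_top"
    and g_zero: "g 0 = 0"
    and g_zero2: "(deriv ^^ 2) g 0 = 0"
    and g_pos: "\<And>z. z < 0 \<Longrightarrow> g z > 0"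
    and G_eq: "G = (\<lambda>z. g (- z))"
    and u_plus_eq: "u_plus = similarity_solution G"
  shows "similarity_ode_solution (- (1 / 3)) G
    \<and> (G \<longlongrightarrow> - 1) at_bot
    \<and> (G \<longlongrightarrow> 1) at_top
    \<and> nde_solution u_plus
    \<and> tendsto_L1_loc (\<lambda>t x. u_plus x t) sgn (at_right 0)"
proof -
  have ode: "similarity_ode_solution (- (1 / 3)) G"
    unfolding G_eq by (rule similarity_ode_solution_reflect[OF g_ode])
  have bot: "(G \<longlongrightarrow> - 1) at_bot"
    unfolding G_eq by (rule filterlim_compose[OF g_at_top filterlim_uminus_at_top_at_bot])
  have top: "(G \<longlongrightarrow> 1) at_top"
    unfolding G_eq by (rule filterlim_compose[OF g_at_bot filterlim_uminus_at_bot_at_top])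
  have "(deriv ^^ 0) G differentiable (at z)" for z
    using ode unfolding similarity_ode_solution_def by (metis zero_less_numeral)
  then have "continuous_on UNIV G"
    by (simp add: differentiable_imp_continuous_on differentiable_on_def)
  then show ?thesis
    unfolding u_plus_eq
    using ode bot top nde_solution_similarity_solution[OF ode]
      similarity_solution_tendsto_L1_loc[OF _ bot top]
    by blast
qed

end
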